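(* Let $\mathcal{M}$ be any deterministic first-order method that satisfies the linear span assumption. Then for every iteration number $T$ (a positive integer) there exist a data matrix $A\in\mathbb{R}^{N\times n}$ and a response vector $b\in\{-1,1\}^N$, where $n=2T$ and $N=8T$, such that the $T$-th approximate solution $x_T$ generated by $\mathcal{M}$ when minimizing the binary logistic loss function $l_{A,b}$ satisfies $$l_{A,b}(x_T)-l_{A,b}^*>\frac{3\|A\|^2\|x_0-x^*\|^2}{32(2T+1)(4T+1)},\qquad \|x_T-x^*\|^2>\frac18\|x_0-x^*\|^2,$$ where $x^*$ is the minimizer of $l_{A,b}$.
   Context: $\|\cdot\|$ is the Euclidean norm of a vector and the spectral norm of a matrix. For $A\in\mathbb{R}^{N\times n}$ with rows $a_i^\top$ and $b\in\{-1,1\}^N$, the (homogeneous) binary logistic loss is $$l_{A,b}(x):=h(Ax)-b^\top Ax=\sum_{i=1}^N 2\log\left[1+\exp\left(-b^{(i)}a_i^\top x\right)\right],\quad x\in\mathbb{R}^n,$$ where for a vector $u\in\mathbb{R}^m$ of any dimension $m$, $h(u):=\sum_{i=1}^m 2\log\left[2\cosh\left(u^{(i)}/2\right)\right]$ and $u^{(i)}$ is the $i$-th component of $u$. Also $l_{A,b}^*:=\min_{x\in\mathbb{R}^n}l_{A,b}(x)$. Deterministic first-order method: an iterative algorithm $\mathcal{M}$ for convex problems $\min_{x\in\mathbb{R}^n}f(x)$ (for any dimension $n$) that accesses $f$ only through the oracle $\mathcal{O}_f(x)=(f(x),f'(x))$, where $f'(x)$ is a subgradient of $f$ at $x$ (the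 gradient $\nabla f(x)$ when $f$ is differentiable). It is described by a problem-independent initial iterate $x_0$ and a sequence of deterministic rules $\{\mathcal{I}_t\}_{t\ge0}$ with $x_{t+1}=\mathcal{I}_t(\mathcal{O}_f(x_0),\ldots,\mathcal{O}_f(x_t))$ for all $t\ge0$. Standing assumptions: $x_0=0$, and $x_t$ is both the inquiry point to the oracle and the approximate solution output by $\mathcal{M}$. Linear span assumption: the iterate sequence $\{x_0,x_1,\ldots\}$ produced by $\mathcal{M}$ on the objective $f$ satisfies $x_t\in\mathrm{span}\{\nabla f(x_0),\ldots,\nabla f(x_{t-1})\}$ for all $t\ge1$. *)

theory Defs
  imports "HOL-Analysis.Analysis"
begin

text \<open>
  A deterministic first-order method on \<open>\<real>\<^sup>n\<close> with \<open>n = CARD('n)\<close>: an initial iterate and, for every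
  \<open>t\<close>, a rule mapping the \<open>t + 1\<close> pairs \<open>(f x\<^sub>s, \<nabla>f x\<^sub>s)\<close> queried so far to the next iterate.
\<close>

datatype ('n::finite) fo_method =
  FO_Method (init: "real ^ 'n") (rule_at: "nat \<Rightarrow> (real \<times> (real ^ 'n)) list \<Rightarrow> real ^ 'n")

definition gradient :: "(real ^ 'n \<Rightarrow> real) \<Rightarrow> real ^ 'n \<Rightarrow> real ^ 'n" where
  "gradient f x = (THE g. GDERIV f x :> g)"

text \<open>Only differentiable objectives occur below, so the subgradient returned is the gradient.\<close>

definition first_order_info :: "(real ^ 'n \<Rightarrow> real) \<Rightarrow> real ^ 'n \<Rightarrow> real \<times> (real ^ 'n)" where
  "first_order_info f x = (f x, gradient f x)"

fun iterate :: "('n::finite) fo_method \<Rightarrow> (real ^ 'n \<Rightarrow> real) \<Rightarrow> nat \<Rightarrow> real ^ 'n" where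
  "iterate M f 0 = init M"
| "iterate M f (Suc t) = rule_at M t (map (\<lambda>s. first_order_info f (iterate M f s)) [0..<Suc t])"

definition linear_span :: "('n::finite) fo_method \<Rightarrow> bool" where
  "linear_span M \<longleftrightarrow>
    (\<forall>f. convex_on UNIV f \<and> (\<forall>x. f differentiable (at x)) \<longrightarrow>
      (\<forall>t\<ge>1. iterate M f t \<in> span ((\<lambda>s. gradient f (iterate M f s)) ` {..<t})))"

definition log_cosh_sum :: "real ^ 'm \<Rightarrow> real" where
  "log_cosh_sum u = (\<Sum>i\<in>UNIV. 2 * ln (2 * cosh (u $ i / 2)))"

definition logistic_loss :: "real ^ 'n ^ 'm \<Rightarrow> real ^ 'm \<Rightarrow> real ^ 'n \<Rightarrow> real" where
  "logistic_loss A b x = log_cosh_sum (A *v x) - b \<bullet> (A *v x)"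

text \<open>A minimum, and not only an infimum, whenever a minimizer exists.\<close>

definition logistic_min :: "real ^ 'n ^ 'm \<Rightarrow> real ^ 'm \<Rightarrow> real" where
  "logistic_min A b = (INF x. logistic_loss A b x)"

definition spectral_norm :: "real ^ 'n ^ 'm \<Rightarrow> real" where
  "spectral_norm A = onorm ((*v) A)"

text \<open>Strictness against every other point: \<open>x\<close> is the unique global minimizer.\<close>

definition is_the_minimizer :: "(real ^ 'n \<Rightarrow> real) \<Rightarrow> real ^ 'n \<Rightarrow> bool" where
  "is_the_minimizer f x \<longleftrightarrow> (\<forall>y. y \<noteq> x \<longrightarrow> f x < f y)"

end

theory Submission
  imports Defs
begin

text \<open>
  Let \<open>w\<^sub>r x = x\<^sub>r - x\<^sub>r\<^sub>+\<^sub>1\<close>, with last row \<open>w\<^sub>n x = x\<^sub>n\<close>, and repeat every \<open>w\<^sub>r\<close> four times in the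
  data, with labels \<open>1, 1, 1, -1\<close>. The loss splits as \<open>\<Sum>\<^sub>r g (w\<^sub>r x)\<close> for a single function \<open>g\<close>
  with strict minimum at \<open>ln 3\<close>, so the minimizer makes every \<open>w\<^sub>r x\<close> equal to \<open>ln 3\<close>. A gradient
  step enlarges the support by at most one coordinate, hence \<open>w\<^sub>r x = 0\<close> for the last \<open>T\<close> rows at
  \<open>x = x\<^sub>T\<close>, which costs at least \<open>T (g 0 - g (ln 3))\<close>, while \<open>\<parallel>A\<parallel>\<^sup>2 \<le> 16\<close>.
\<close>

section \<open>The scalar loss and its strict minimum\<close>

text \<open>The \<open>g\<close> of the overview: four copies of a row give the factor 4 * 2 = 8,
  and their labels 1, 1, 1, -1 sum to 2.\<close>

definition link_loss :: "real \<Rightarrow> real" where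
  "link_loss y = 8 * ln (2 * cosh (y / 2)) - 2 * y"

text \<open>Turns minimization over \<open>y\<close> into a polynomial inequality in
  \<open>exp y\<close>.\<close>

lemma link_loss_eq: "link_loss y = 2 * ln ((exp y + 1) ^ 4 / exp y ^ 3)"
proof -
  have "2 * cosh (y / 2) * exp (y / 2) = exp (y / 2) * exp (y / 2) + exp (- (y / 2)) * exp (y / 2)"
    by (simp add: cosh_field_def field_simps)
  also have "\<dots> = exp y + 1"
    by (simp flip: exp_add)
  finally have "ln (2 * cosh (y / 2)) + y / 2 = ln (exp y + 1)"
    by (metis cosh_real_pos exp_gt_zero ln_exp ln_mult_pos mult_pos_pos zero_less_numeral)
  moreover have "ln ((exp y + 1) ^ 4 / exp y ^ 3) = 4 * ln (exp y + 1) - 3 * y"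
    using add_pos_pos[OF exp_gt_zero[of y] zero_less_one]
    by (subst ln_divide_pos) (simp_all add: ln_realpow)
  ultimately show ?thesis
    by (simp add: link_loss_def)
qed

lemma link_loss_ln_3: "link_loss (ln 3) = 2 * ln (256 / 27)"
  by (simp add: link_loss_eq)

lemma link_loss_min_strict:
  assumes "y \<noteq> ln 3"
  shows "link_loss (ln 3) < link_loss y"
proof -
  define w where "w = exp y"
  have w: "w > 0" "w \<noteq> 3"
    using assms by (auto simp: w_def) (metis ln_exp)
  \<comment> \<open>256 / 27 is the value of \<open>(w + 1) ^ 4 / w ^ 3\<close> at w = 3. Being a
    minimum, it makes 3 a double root of the difference, and the cofactor has only positive
    coefficients.\<close>
  have "27 * (w + 1) ^ 4 - 256 * w ^ 3 = (w - 3)\<^sup>2 * (27 * w\<^sup>2 + 14 * w + 3)"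
    by (simp add: power2_eq_square power3_eq_cube power4_eq_xxxx algebra_simps)
  moreover have "\<dots> > 0"
    using w by (intro mult_pos_pos add_pos_pos) auto
  ultimately have "256 / 27 < (w + 1) ^ 4 / w ^ 3"
    using w by (simp add: field_simps)
  then have "ln (256 / 27) < ln ((w + 1) ^ 4 / w ^ 3)"
    using w by (subst ln_less_cancel_iff) auto
  then show ?thesis
    unfolding link_loss_eq[of y] link_loss_ln_3 w_def by simp
qed

lemma link_loss_min: "link_loss (ln 3) \<le> link_loss y"
  using link_loss_min_strict[of y] by (cases "y = ln 3") auto

text \<open>The factor 1/2 is the 16 / 32 that arises in the final bound from the estimate 16 for
  the squared spectral norm. The number 1 separates the two sides.\<close>

lemma link_loss_gap: "link_loss 0 - link_loss (ln 3) > (ln 3)\<^sup>2 / 2"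
proof -
  have "link_loss 0 - link_loss (ln 3) = 2 * (ln 16 - ln (256 / 27))"
    by (simp add: link_loss_eq)
  also have "ln 16 - ln (256 / 27 :: real) = ln (16 / (256 / 27))"
    by (rule ln_divide_pos[symmetric]) auto
  finally have gap: "link_loss 0 - link_loss (ln 3) = ln ((27 / 16) ^ 2)"
    by (simp add: ln_realpow)
  \<comment> \<open>(27 / 16)^2 = 729 / 256 is about 2.85.\<close>
  have "exp 1 < (27 / 16 :: real) ^ 2"
    using e_less_272 by (simp add: power2_eq_square)
  then have "1 < ln ((27 / 16 :: real) ^ 2)"
    by (metis exp_gt_zero less_trans ln_exp ln_less_cancel_iff)
  \<comment> \<open>A coarse bound suffices: (25 / 18)^2 / 2 = 625 / 648 < 1.\<close>
  moreover have "ln 3 \<le> (25 / 18 :: real)"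
  proof -
    have "ln 3 \<le> ln (2 ^ 2 :: real)" by (subst ln_le_cancel_iff) auto
    also have "\<dots> = 2 * ln 2" by (subst ln_realpow) auto
    finally show ?thesis using ln2_le_25_over_36 by simp
  qed
  then have "(ln 3)\<^sup>2 \<le> (25 / 18 :: real)\<^sup>2"
    by (intro power_mono) auto
  ultimately show ?thesis
    unfolding gap by (simp add: power2_eq_square)
qed

lemma link_loss_has_real_derivative:
  "(link_loss has_real_derivative 4 * tanh (y / 2) - 2) (at y)"
proof -
  have "cosh (y / 2) > 0" by (rule cosh_real_pos)
  then show ?thesis
    unfolding link_loss_def[abs_def]
    by (auto intro!: derivative_eq_intros simp: tanh_def field_simps)
qed

lemma convex_link_loss: "convex_on UNIV link_loss"
  by (rule convex_on_realI[where f' = "\<lambda>y. 4 * tanh (y / 2) - 2"])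
    (auto intro: link_loss_has_real_derivative)

section \<open>Norms, convex sums and uniqueness of gradients\<close>

lemma power2_norm_vec: "(norm x)\<^sup>2 = (\<Sum>i\<in>UNIV. (x $ i)\<^sup>2)"
  for x :: "real ^ 'n"
  unfolding power2_norm_eq_inner inner_vec_def by (simp add: power2_eq_square)

lemma convex_on_sum_fun:
  assumes "convex S" "\<And>i. i \<in> I \<Longrightarrow> convex_on S (f i)"
  shows "convex_on S (\<lambda>x. \<Sum>i\<in>I. f i x)"
  using assms(2) by (induction I rule: infinite_finite_induct) (auto simp: assms(1) convex_on_const)

text \<open>\<open>gradient\<close> is a definite description, so uniqueness is at stake: two
  candidates are compared in the direction of their difference.\<close>

lemma gradient_eqI:
  fixes f :: "real ^ 'n \<Rightarrow> real"
  assumes "GDERIV f x :> g"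
  shows "gradient f x = g"
  unfolding gradient_def
proof (rule the_equality)
  show "GDERIV f x :> g" by fact
next
  fix g' assume "GDERIV f x :> g'"
  then have "(\<lambda>h. h \<bullet> g') = (\<lambda>h. h \<bullet> g)"
    using assms unfolding gderiv_def by (rule has_derivative_unique)
  then have "(g' - g) \<bullet> g' = (g' - g) \<bullet> g"
    by (rule fun_cong)
  then have "(g' - g) \<bullet> (g' - g) = 0"
    unfolding inner_diff_right[of _ g' g] by (rule right_minus_eq[THEN iffD2])
  then show "g' = g"
    by (simp only: inner_eq_zero_iff right_minus_eq)
qed

section \<open>The hard instance and its minimizer\<close>

text \<open>The index types carry no order or product structure; \<open>ix\<close> numbers the
  coordinates from 0, and \<open>q\<close> identifies a data row with a coordinate and one of four
  copies.\<close>

locale hard_instance =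
  fixes ix :: "'n::finite \<Rightarrow> nat"
    and q :: "'m::finite \<Rightarrow> 'n \<times> bool \<times> bool"
  assumes ix: "bij_betw ix UNIV {..<CARD('n)}"
    and q: "bij q"
begin

text \<open>For the last coordinate the second case never occurs, which produces the boundary row of
  the overview.\<close>

definition link :: "'n \<Rightarrow> real ^ 'n" where
  "link r = (\<chi> j. if ix j = ix r then 1 else if ix j = Suc (ix r) then - 1 else 0)"

definition A :: "real ^ 'n ^ 'm" where
  "A = (\<chi> i. link (fst (q i)))"

definition b :: "real ^ 'm" where
  "b = (\<chi> i. if snd (q i) = (True, True) then - 1 else 1)"

definition xstar :: "real ^ 'n" where
  "xstar = (\<chi> j. ln 3 * (real CARD('n) - real (ix j)))"

text \<open>The span of the first \<open>t\<close> coordinate vectors, which will contain the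
  iterate \<open>x_t\<close>.\<close>

definition leading :: "nat \<Rightarrow> (real ^ 'n) set" where
  "leading t = {x. \<forall>j. t \<le> ix j \<longrightarrow> x $ j = 0}"

lemma ix_less: "ix j < CARD('n)"
  using ix by (auto dest: bij_betwE)

lemma ix_eq_iff: "ix i = ix j \<longleftrightarrow> i = j"
  using ix by (auto simp: bij_betw_def dest: injD)

lemma ix_ex: "k < CARD('n) \<Longrightarrow> \<exists>j. ix j = k"
  using bij_betw_imp_surj_on[OF ix] by (metis lessThan_iff imageE)

lemma sum_ix: "(\<Sum>j\<in>UNIV. F (ix j)) = (\<Sum>k<CARD('n). F k)"
  by (rule sum.reindex_bij_betw[OF ix])

text \<open>\<open>F\<close> takes row and copy separately because only the label depends on the
  copy.\<close>

lemma sum_rows: "(\<Sum>i\<in>UNIV. F (fst (q i)) (snd (q i))) =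
    (\<Sum>r\<in>UNIV. F r (False, False) + F r (False, True) + F r (True, False) + F r (True, True))"
  for F :: "'n \<Rightarrow> bool \<times> bool \<Rightarrow> real"
proof -
  have "(\<Sum>i\<in>UNIV. F (fst (q i)) (snd (q i))) = (\<Sum>p\<in>UNIV. F (fst p) (snd p))"
    by (rule sum.reindex_bij_betw[OF q])
  also have "\<dots> = (\<Sum>r\<in>UNIV. \<Sum>p\<in>UNIV. F r p)"
    by (simp add: sum.cartesian_product case_prod_beta flip: UNIV_Times_UNIV)
  also have "\<dots> = (\<Sum>r\<in>UNIV. F r (False, False) + F r (False, True) + F r (True, False) + F r (True, True))"
    by (simp add: UNIV_bool add.assoc flip: UNIV_Times_UNIV)
  finally show ?thesis .
qed

lemma link_inner_last: "link r \<bullet> x = x $ r" if "Suc (ix r) = CARD('n)"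
proof -
  have "link r $ j * x $ j = (if j = r then x $ j else 0)" for j
    using that ix_less[of j] by (simp add: link_def ix_eq_iff)
  then show ?thesis by (simp add: inner_vec_def)
qed

lemma link_inner_Suc: "link r \<bullet> x = x $ r - x $ s" if "ix s = Suc (ix r)"
proof -
  have "link r $ j * x $ j = (if j = r then x $ j else 0) - (if j = s then x $ j else 0)" for j
    using that ix_eq_iff[of j r] ix_eq_iff[of j s] by (auto simp: link_def)
  then show ?thesis by (simp add: inner_vec_def sum_subtractf)
qed

lemma link_cases:
  obtains "Suc (ix r) = CARD('n)" | s where "ix s = Suc (ix r)"
  using ix_ex[of "Suc (ix r)"] Suc_lessI[OF ix_less[of r]] by blast

lemma logistic_loss_A_b: "logistic_loss A b x = (\<Sum>r\<in>UNIV. link_loss (link r \<bullet> x))"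
proof -
  have "logistic_loss A b x = (\<Sum>i\<in>UNIV. (\<lambda>r p. 2 * ln (2 * cosh (link r \<bullet> x / 2))
      - (if p = (True, True) then - 1 else 1) * (link r \<bullet> x)) (fst (q i)) (snd (q i)))"
    unfolding logistic_loss_def log_cosh_sum_def inner_vec_def[of b]
    by (simp add: A_def b_def matrix_mult_dot sum_subtractf)
  also have "\<dots> = (\<Sum>r\<in>UNIV. link_loss (link r \<bullet> x))"
    by (subst sum_rows) (simp add: link_loss_def)
  finally show ?thesis .
qed

lemma link_inner_xstar: "link r \<bullet> xstar = ln 3"
  by (rule link_cases[of r])
    (simp_all add: link_inner_last link_inner_Suc xstar_def flip: right_diff_distrib of_nat_Suc)

text \<open>The linear system is upper bidiagonal, so back substitution from the last coordinate
  determines \<open>x\<close>; the induction measure is the distance to the end.\<close>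

lemma eq_xstarI:
  assumes "\<And>r. link r \<bullet> x = ln 3"
  shows "x = xstar"
proof -
  have "x $ j = xstar $ j" for j
  proof (induction "CARD('n) - ix j" arbitrary: j rule: less_induct)
    case less
    show ?case
    proof (rule link_cases[of j])
      assume "Suc (ix j) = CARD('n)"
      then show ?thesis
        using assms[of j] link_inner_xstar[of j] by (simp add: link_inner_last)
    next
      fix s assume s: "ix s = Suc (ix j)"
      then have "x $ s = xstar $ s"
        using ix_less[of s] by (intro less) auto
      then show ?thesis
        using assms[of j] link_inner_xstar[of j] s by (simp add: link_inner_Suc)
    qed
  qed
  then show ?thesis by (simp add: vec_eq_iff)
qed

lemma loss_xstar: "logistic_loss A b xstar = real CARD('n) * link_loss (ln 3)"
  by (simp add: logistic_loss_A_b link_inner_xstar)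

lemma is_the_minimizer_xstar: "is_the_minimizer (logistic_loss A b) xstar"
  unfolding is_the_minimizer_def
proof (intro allI impI)
  fix y assume "y \<noteq> xstar"
  then obtain r where "link r \<bullet> y \<noteq> ln 3"
    using eq_xstarI by blast
  then have "(\<Sum>r\<in>(UNIV::'n set). link_loss (ln 3)) < (\<Sum>r\<in>UNIV. link_loss (link r \<bullet> y))"
    by (intro sum_strict_mono_ex1) (auto intro: link_loss_min link_loss_min_strict)
  then show "logistic_loss A b xstar < logistic_loss A b y"
    unfolding loss_xstar unfolding logistic_loss_A_b by simp
qed

lemma logistic_min_A_b: "logistic_min A b = real CARD('n) * link_loss (ln 3)"
  unfolding logistic_min_def
proof (rule cInf_eq_minimum)
  show "real CARD('n) * link_loss (ln 3) \<in> range (logistic_loss A b)"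
    by (metis loss_xstar rangeI)
next
  fix y assume "y \<in> range (logistic_loss A b)"
  then obtain x where "y = logistic_loss A b x" by auto
  then show "real CARD('n) * link_loss (ln 3) \<le> y"
    using is_the_minimizer_xstar unfolding is_the_minimizer_def
    by (cases "x = xstar") (auto simp: loss_xstar dest: less_imp_le)
qed

section \<open>Gradients and the subspaces reachable by the method\<close>

lemma convex_loss: "convex_on UNIV (logistic_loss A b)"
proof -
  have "convex_on UNIV (\<lambda>x. link_loss (link r \<bullet> x))" for r
    using convex_link_loss by (auto simp: convex_on_def inner_add_right)
  then show ?thesis
    unfolding logistic_loss_A_b[abs_def] by (intro convex_on_sum_fun) auto
qed

lemma GDERIV_loss:
  "GDERIV (logistic_loss A b) x :> (\<Sum>r\<in>UNIV. (4 * tanh (link r \<bullet> x / 2) - 2) *\<^sub>R link r)"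
proof -
  have "((\<lambda>x. link_loss (link r \<bullet> x)) has_derivative
      (\<lambda>h. (4 * tanh (link r \<bullet> x / 2) - 2) * (link r \<bullet> h))) (at x)" for r
    by (rule has_derivative_compose[where f = "\<lambda>x. link r \<bullet> x" and g = link_loss])
      (auto intro!: derivative_eq_intros
        link_loss_has_real_derivative[unfolded has_field_derivative_def])
  then show ?thesis
    unfolding gderiv_def logistic_loss_A_b[abs_def]
    by (auto intro!: derivative_eq_intros simp: inner_sum_right inner_commute)
qed

lemma leading_subspace: "subspace (leading t)"
  by (auto simp: subspace_def leading_def)

lemma link_inner_leading: "link r \<bullet> x = 0" if "x \<in> leading t" "t \<le> ix r"
  by (rule link_cases[of r]) (use that in \<open>auto simp: leading_def link_inner_last link_inner_Suc\<close>)

text \<open>Beyond the support of \<open>x\<close> all links have the same slope, so the gradient telescopes there.\<close>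

lemma gradient_loss_leading:
  assumes "x \<in> leading t"
  shows "gradient (logistic_loss A b) x \<in> leading (Suc t)"
proof -
  have "(\<Sum>r\<in>UNIV. (4 * tanh (link r \<bullet> x / 2) - 2) * link r $ j) = 0" if j: "Suc t \<le> ix j" for j
  proof -
    obtain p where "ix p = ix j - 1"
      using ix_ex[of "ix j - 1"] ix_less[of j] less_imp_diff_less by blast
    then have p: "ix j = Suc (ix p)"
      using j by simp
    \<comment> \<open>Only rows \<open>p\<close> and \<open>j\<close> involve coordinate
      \<open>j\<close>. Since \<open>Suc t \<le> ix j\<close>, both have index at least
      \<open>t\<close>, so their links vanish at \<open>x\<close> and both slopes are -2.\<close>
    have "(4 * tanh (link r \<bullet> x / 2) - 2) * link r $ j =
        2 * (if r = p then 1 else 0) - 2 * (if r = j then 1 else 0)" for r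
      using p j link_inner_leading[OF assms, of r] by (auto simp: link_def ix_eq_iff)
    then show ?thesis
      by (simp add: sum_subtractf flip: sum_distrib_left)
  qed
  then show ?thesis
    unfolding gradient_eqI[OF GDERIV_loss] by (simp add: leading_def)
qed

text \<open>For s < t the gradient at \<open>x_s\<close> lies in \<open>leading (Suc s)\<close>,
  hence in the subspace \<open>leading t\<close>, which then contains the whole span. The start at 0
  provides the case t = 0.\<close>

lemma iterate_leading:
  assumes "init M = 0" "linear_span M"
  shows "iterate M (logistic_loss A b) t \<in> leading t"
proof (induction t rule: less_induct)
  case (less t)
  let ?f = "logistic_loss A b"
  show ?case
  proof (cases "t = 0")
    case True
    then show ?thesis using assms(1) by (simp add: leading_def)
  next
    case False
    have "gradient ?f (iterate M ?f s) \<in> leading t" if "s < t" for s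
      using gradient_loss_leading[OF less.IH[OF that]] that by (auto simp: leading_def)
    then have "span ((\<lambda>s. gradient ?f (iterate M ?f s)) ` {..<t}) \<subseteq> leading t"
      by (intro span_minimal leading_subspace) auto
    moreover have "\<forall>x. ?f differentiable (at x)"
      using GDERIV_loss unfolding gderiv_def differentiable_def by blast
    ultimately show ?thesis
      using assms(2) convex_loss False unfolding linear_span_def by (auto simp: Suc_le_eq)
  qed
qed

section \<open>Loss gap, distance to the minimizer and spectral norm\<close>

text \<open>Each row of index at least \<open>t\<close> has link 0 and pays the full scalar gap;
  every other row pays at least 0.\<close>

lemma loss_leading_gap:
  assumes "x \<in> leading t" "t \<le> CARD('n)"
  shows "logistic_loss A b x - logistic_min A b
    \<ge> real (CARD('n) - t) * (link_loss 0 - link_loss (ln 3))"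
proof -
  have "(\<Sum>r\<in>(UNIV::'n set). if t \<le> ix r then link_loss 0 - link_loss (ln 3) else 0)
      = (\<Sum>k<CARD('n). if t \<le> k then link_loss 0 - link_loss (ln 3) else 0)"
    by (rule sum_ix)
  also have "\<dots> = (\<Sum>k\<in>{t..<CARD('n)}. link_loss 0 - link_loss (ln 3))"
    by (rule sum.mono_neutral_cong_right) auto
  also have "\<dots> = real (CARD('n) - t) * (link_loss 0 - link_loss (ln 3))"
    by simp
  finally have "real (CARD('n) - t) * (link_loss 0 - link_loss (ln 3)) =
      (\<Sum>r\<in>(UNIV::'n set). if t \<le> ix r then link_loss 0 - link_loss (ln 3) else 0)" ..
  also have "\<dots> \<le> (\<Sum>r\<in>UNIV. link_loss (link r \<bullet> x) - link_loss (ln 3))"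
    using link_inner_leading[OF assms(1)] link_loss_min by (intro sum_mono) auto
  finally show ?thesis
    by (simp add: logistic_loss_A_b logistic_min_A_b sum_subtractf)
qed

lemma norm_xstar: "(norm xstar)\<^sup>2 = (ln 3)\<^sup>2 * (\<Sum>k<CARD('n). (real (CARD('n) - k))\<^sup>2)"
proof -
  have "(norm xstar)\<^sup>2 = (\<Sum>j\<in>UNIV. (ln 3)\<^sup>2 * (real (CARD('n) - ix j))\<^sup>2)"
    using ix_less by (simp add: power2_norm_vec xstar_def power_mult_distrib of_nat_diff less_imp_le)
  also have "\<dots> = (ln 3)\<^sup>2 * (\<Sum>k<CARD('n). (real (CARD('n) - k))\<^sup>2)"
    by (subst sum_ix) (simp add: sum_distrib_left)
  finally show ?thesis .
qed

text \<open>From index \<open>t\<close> on \<open>x\<close> vanishes, so the error there is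
  \<open>xstar\<close> itself; the earlier coordinates are dropped.\<close>

lemma norm_diff_xstar:
  assumes "x \<in> leading t"
  shows "(norm (x - xstar))\<^sup>2 \<ge> (ln 3)\<^sup>2 * (\<Sum>k\<in>{t..<CARD('n)}. (real (CARD('n) - k))\<^sup>2)"
proof -
  have "(ln 3)\<^sup>2 * (\<Sum>k\<in>{t..<CARD('n)}. (real (CARD('n) - k))\<^sup>2)
      = (\<Sum>k<CARD('n). if t \<le> k then (ln 3)\<^sup>2 * (real (CARD('n) - k))\<^sup>2 else 0)"
    unfolding sum_distrib_left by (rule sum.mono_neutral_cong_left) auto
  also have "\<dots> = (\<Sum>j\<in>UNIV. if t \<le> ix j then (ln 3)\<^sup>2 * (real (CARD('n) - ix j))\<^sup>2 else 0)"
    by (rule sum_ix[symmetric])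
  also have "\<dots> \<le> (\<Sum>j\<in>UNIV. (x $ j - xstar $ j)\<^sup>2)"
    using assms ix_less
    by (intro sum_mono) (auto simp: leading_def xstar_def power_mult_distrib of_nat_diff less_imp_le)
  also have "\<dots> = (norm (x - xstar))\<^sup>2"
    by (simp add: power2_norm_vec)
  finally show ?thesis .
qed

text \<open>Each link is a difference of two coordinates and each coordinate occurs in at most two
  links: 4 copies * 2 * 2 = 16.\<close>

lemma spectral_norm_A: "(spectral_norm A)\<^sup>2 \<le> 16"
proof -
  have "norm (A *v x) \<le> 4 * norm x" for x
  proof -
    \<comment> \<open>The value 0 at index \<open>CARD('n)\<close> makes the last row a difference
      like all others.\<close>
    define y where "y k = (if k < CARD('n) then x $ (inv ix k) else 0)" for k
    have y: "x $ j = y (ix j)" for j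
      using ix_less[of j] by (simp add: y_def inv_f_f inj_on_def ix_eq_iff)
    have ylast: "y CARD('n) = 0"
      by (simp add: y_def)
    have "link r \<bullet> x = y (ix r) - y (Suc (ix r))" for r
      by (rule link_cases[of r])
        (simp_all add: link_inner_last link_inner_Suc ylast y)
    then have "(norm (A *v x))\<^sup>2 = (\<Sum>i\<in>UNIV.
        (\<lambda>r p. (y (ix r) - y (Suc (ix r)))\<^sup>2) (fst (q i)) (snd (q i)))"
      by (simp add: power2_norm_vec A_def matrix_mult_dot)
    also have "\<dots> = (\<Sum>r\<in>UNIV. 4 * (y (ix r) - y (Suc (ix r)))\<^sup>2)"
      by (subst sum_rows) simp
    also have "\<dots> = (\<Sum>k<CARD('n). 4 * (y k - y (Suc k))\<^sup>2)"
      by (rule sum_ix)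
    also have "\<dots> \<le> (\<Sum>k<CARD('n). 8 * (y k)\<^sup>2 + 8 * (y (Suc k))\<^sup>2)"
    proof (rule sum_mono)
      fix k
      \<comment> \<open>The right side minus the left side is four times this square.\<close>
      have "0 \<le> (y k + y (Suc k))\<^sup>2" by simp
      then show "4 * (y k - y (Suc k))\<^sup>2 \<le> 8 * (y k)\<^sup>2 + 8 * (y (Suc k))\<^sup>2"
        by (simp add: power2_eq_square algebra_simps)
    qed
    also have "\<dots> = 8 * (\<Sum>k<CARD('n). (y k)\<^sup>2) + 8 * (\<Sum>k<CARD('n). (y (Suc k))\<^sup>2)"
      by (simp add: sum.distrib sum_distrib_left)
    \<comment> \<open>The shift loses the square of \<open>y 0\<close> and gains only the square of
      \<open>y CARD('n)\<close>, which is 0.\<close>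
    also have "(\<Sum>k<CARD('n). (y (Suc k))\<^sup>2) \<le> (\<Sum>k<CARD('n). (y k)\<^sup>2)"
      using sum.lessThan_Suc_shift[of "\<lambda>k. (y k)\<^sup>2" "CARD('n)"] by (simp add: ylast)
    finally have "(norm (A *v x))\<^sup>2 \<le> 16 * (\<Sum>k<CARD('n). (y k)\<^sup>2)"
      by simp
    also have "(\<Sum>k<CARD('n). (y k)\<^sup>2) = (norm x)\<^sup>2"
      by (simp add: power2_norm_vec y sum_ix[of "\<lambda>k. (y k)\<^sup>2"])
    finally have "(norm (A *v x))\<^sup>2 \<le> (4 * norm x)\<^sup>2"
      by (simp add: power_mult_distrib)
    then show ?thesis
      by (rule power2_le_imp_le) simp
  qed
  then have "spectral_norm A \<le> 4"
    unfolding spectral_norm_def by (intro onorm_bound) auto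
  moreover have "0 \<le> spectral_norm A"
    unfolding spectral_norm_def by (intro onorm_pos_le) (simp add: linear_linear matrix_vector_mul_linear)
  ultimately have "(spectral_norm A)\<^sup>2 \<le> 4\<^sup>2"
    by (intro power_mono)
  then show ?thesis by simp
qed

end

section \<open>Assembling the two bounds\<close>

text \<open>The sum 1^2 + ... + (n - t)^2 read downwards; the induction splits off its largest term,
  at k = t.\<close>

lemma sum_squares_down:
  "t \<le> n \<Longrightarrow> (\<Sum>k\<in>{t..<n}. (real (n - k))\<^sup>2) =
    real (n - t) * (real (n - t) + 1) * (2 * real (n - t) + 1) / 6"
proof (induction "n - t" arbitrary: t)
  case (Suc d)
  then have "{t..<n} = insert t {Suc t..<n}" "d = n - Suc t" "Suc t \<le> n" by auto
  moreover have "real (n - t) = real (n - Suc t) + 1"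
    using Suc.hyps by linarith
  ultimately show ?case
    using Suc.hyps(1)[of "Suc t"] by (simp add: power2_eq_square field_simps)
qed auto

theorem theorem2p5:
  fixes M :: "('n::finite) fo_method" and T :: nat
  assumes "init M = 0"
    and "linear_span M"
    and "T \<ge> 1"
    and "CARD('n) = 2 * T"
    and "CARD('m::finite) = 8 * T"
  shows "\<exists>(A :: real ^ 'n ^ 'm) (b :: real ^ 'm) (xstar :: real ^ 'n).
    (\<forall>i. b $ i \<in> {-1, 1}) \<and>
    is_the_minimizer (logistic_loss A b) xstar \<and>
    logistic_loss A b (iterate M (logistic_loss A b) T) - logistic_min A b
      > 3 * (spectral_norm A)\<^sup>2 * (norm (iterate M (logistic_loss A b) 0 - xstar))\<^sup>2
        / (32 * (2 * real T + 1) * (4 * real T + 1)) \<and>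
    (norm (iterate M (logistic_loss A b) T - xstar))\<^sup>2
      > 1 / 8 * (norm (iterate M (logistic_loss A b) 0 - xstar))\<^sup>2"
proof -
  obtain ix :: "'n \<Rightarrow> nat" where ix: "bij_betw ix UNIV {..<CARD('n)}"
    using finite_same_card_bij[of "UNIV :: 'n set" "{..<CARD('n)}"] by auto
  \<comment> \<open>Both sides have 2T * 4 = 8T elements.\<close>
  obtain q :: "'m \<Rightarrow> 'n \<times> bool \<times> bool" where q: "bij q"
    using finite_same_card_bij[of "UNIV :: 'm set" "UNIV :: ('n \<times> bool \<times> bool) set"] assms
    by auto
  interpret hard_instance ix q
    using ix q by unfold_locales
  let ?f = "logistic_loss A b"
  let ?x = "iterate M ?f T"
  let ?P = "(2 * real T + 1) * (4 * real T + 1)"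
  have x: "?x \<in> leading T"
    using assms by (intro iterate_leading)
  have P: "?P > 0" by (intro mult_pos_pos) auto
  \<comment> \<open>The squares from 1 to 2T sum to 2T(2T + 1)(4T + 1) / 6, so \<open>?P\<close>
    cancels the denominator of the claimed bound.\<close>
  have ns: "(norm xstar)\<^sup>2 = (ln 3)\<^sup>2 * (real T * ?P / 3)"
    unfolding norm_xstar lessThan_atLeast0 using assms
    by (subst sum_squares_down) (simp_all add: field_simps)
  have "3 * (spectral_norm A)\<^sup>2 * (norm xstar)\<^sup>2 / (32 * ?P) = (spectral_norm A)\<^sup>2 * (ln 3)\<^sup>2 * real T / 32"
    unfolding ns using P by (simp add: divide_simps)
  also have "\<dots> \<le> 16 * (ln 3)\<^sup>2 * real T / 32"
    using spectral_norm_A by (intro divide_right_mono mult_right_mono) auto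
  also have "\<dots> = real T * ((ln 3)\<^sup>2 / 2)" by simp
  also have "\<dots> < real T * (link_loss 0 - link_loss (ln 3))"
    using link_loss_gap assms(3) by (intro mult_strict_left_mono) auto
  also have "\<dots> \<le> ?f ?x - logistic_min A b"
    using loss_leading_gap[OF x] assms by simp
  finally have gap: "?f ?x - logistic_min A b > 3 * (spectral_norm A)\<^sup>2 * (norm xstar)\<^sup>2 / (32 * ?P)" .
  have "1 / 8 * (norm xstar)\<^sup>2 = (ln 3)\<^sup>2 * (real T * (2 * real T + 1) * (4 * real T + 1) / 24)"
    unfolding ns by simp
  \<comment> \<open>The squares from 1 to T sum to T(T + 1)(2T + 1) / 6, written here over 24; the
    strict gain is 4T + 1 < 4T + 4.\<close>
  also have "\<dots> < (ln 3)\<^sup>2 * (real T * (2 * real T + 1) * (4 * real T + 4) / 24)"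
    using assms(3) by (intro mult_strict_left_mono divide_strict_right_mono) auto
  also have "\<dots> = (ln 3)\<^sup>2 * (\<Sum>k\<in>{T..<CARD('n)}. (real (CARD('n) - k))\<^sup>2)"
    using assms by (subst sum_squares_down) (simp_all add: field_simps)
  also have "\<dots> \<le> (norm (?x - xstar))\<^sup>2"
    by (rule norm_diff_xstar[OF x])
  finally have dist: "(norm (?x - xstar))\<^sup>2 > 1 / 8 * (norm xstar)\<^sup>2" .
  have labels: "\<forall>i. b $ i \<in> {-1, 1}"
    by (simp add: b_def)
  have x0: "norm (iterate M ?f 0 - xstar) = norm xstar"
    using assms(1) by simp
  have den: "32 * (2 * real T + 1) * (4 * real T + 1) = 32 * ?P"
    by (simp only: mult.assoc)
  show ?thesis
    using labels is_the_minimizer_xstar gap[folded x0 den] dist[folded x0] by blast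
qed

end
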